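(* If $K$ is a compact convex subset of $\mathbb{R}^n$ having at least $n+1$ exposed points, then there exists an $n$-dimensional simplex $S$ in $\mathbb{R}^n$ such that for each unit vector $u$ the projection $S_u$ contains a translate of the projection $K_u$, while $S$ does not contain a translate of $K$.
   Context: For a unit vector $u$ and a set $S\subseteq\mathbb{R}^n$, $S_u$ denotes the orthogonal projection onto $u^\perp$. A point $x\in K$ is an exposed point of $K$ if there is a unit vector $u$ such that $x$ is the unique point of $K$ maximizing $y\mapsto y\cdot u$ over $K$. *)

theory Defs
  imports "HOL-Analysis.Analysis"
begin

definition proj_perp :: "'a::euclidean_space \<Rightarrow> 'a set \<Rightarrow> 'a set" where
  "proj_perp u S = (\<lambda>x. x - (x \<bullet> u) *\<^sub>R u) ` S"

definition exposed_point :: "'a::euclidean_space set \<Rightarrow> 'a \<Rightarrow> bool" where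
  "exposed_point K x \<longleftrightarrow> x \<in> K \<and>
     (\<exists>u. norm u = 1 \<and> (\<forall>y\<in>K. y \<bullet> u \<le> x \<bullet> u) \<and> (\<forall>y\<in>K. y \<bullet> u = x \<bullet> u \<longrightarrow> y = x))"

definition contains_translate :: "'a::real_vector set \<Rightarrow> 'a set \<Rightarrow> bool" where
  "contains_translate A B \<longleftrightarrow> (\<exists>t. (\<lambda>x. t + x) ` B \<subseteq> A)"

end

theory Submission
  imports Defs
begin

text \<open>Circumscribe about \<open>K\<close> a simplex whose facets touch \<open>K\<close> in single, pairwise distinct points.
  Given a direction \<open>u\<close>, translate \<open>K\<close> slightly off the facets parallel to \<open>u\<close>; every point of \<open>K\<close>
  can then be moved along \<open>\<plusminus>u\<close> into the interior of the simplex. By compactness of the sphere the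
  same works with all facets pushed inwards by some \<open>e > 0\<close> independent of \<open>u\<close>. The smaller simplex
  contains no translate of \<open>K\<close>, because the facet normals \<open>s\<close> satisfy a positive dependency
  \<open>\<Sum> a s *\<^sub>R s = 0\<close>, so the weighted sum of the support values is invariant under translation.

  To find the facet normals, add exposing directions to those of the given exposed points until the
  sum is zero; a perturbation into general position keeps the family positively spanning and the
  exposed points distinct, and Caratheodory's theorem extracts \<open>DIM('a) + 1\<close> of the directions.\<close>

text \<open>A finite subcover leaves finitely many local constants, and by monotonicity their
  minimum works everywhere. The element \<open>1\<close> in \<open>m\<close> covers an empty
  subcover.\<close>

lemma compact_uniform_eps:
  fixes G :: "'b::metric_space \<Rightarrow> real \<Rightarrow> bool"
  assumes "compact C"
    and loc: "\<And>u. u \<in> C \<Longrightarrow> \<exists>d>0. \<exists>e>0. \<forall>v\<in>ball u d. G v e"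
    and mono: "\<And>u e e'. G u e \<Longrightarrow> 0 < e' \<Longrightarrow> e' \<le> e \<Longrightarrow> G u e'"
  shows "\<exists>e>0. \<forall>u\<in>C. G u e"
proof -
  obtain d e where de: "\<And>u. u \<in> C \<Longrightarrow> d u > 0 \<and> e u > 0 \<and> (\<forall>v\<in>ball u (d u). G v (e u))"
    using loc by metis
  have "C \<subseteq> (\<Union>u\<in>C. ball u (d u))" using de by force
  then obtain T where T: "T \<subseteq> C" "finite T" "C \<subseteq> (\<Union>u\<in>T. ball u (d u))"
    using compactE_image[OF \<open>compact C\<close>, of C "\<lambda>u. ball u (d u)"] by auto
  define m where "m = Min (insert 1 (e ` T))"
  have "m > 0" unfolding m_def using T de by (subst Min_gr_iff) auto
  moreover have "G v m" if v: "v \<in> C" for v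
  proof -
    obtain u where u: "u \<in> T" "v \<in> ball u (d u)" using T(3) v by blast
    have "m \<le> e u" unfolding m_def using T u by (intro Min_le) auto
    then show ?thesis using mono[of v "e u" m] de[of u] u T \<open>m > 0\<close> by auto
  qed
  ultimately show ?thesis by blast
qed

subsection \<open>Exposing directions\<close>

text \<open>Without normalising \<open>u\<close>, the exposing directions of a fixed point are
  closed under sums and positive multiples.\<close>

definition exposes :: "'a::euclidean_space set \<Rightarrow> 'a \<Rightarrow> 'a \<Rightarrow> bool" where
  "exposes K u x \<longleftrightarrow> x \<in> K \<and> (\<forall>y\<in>K. y \<noteq> x \<longrightarrow> y \<bullet> u < x \<bullet> u)"

lemma exposed_point_exposes:
  assumes "exposed_point K x"
  shows "\<exists>u. exposes K u x"
  using assms unfolding exposed_point_def exposes_def by (metis less_eq_real_def)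

lemma exposes_unique: "exposes K u x \<Longrightarrow> exposes K u y \<Longrightarrow> x = y"
  unfolding exposes_def by (metis less_asym)

lemma exposes_sum_scaled:
  assumes "finite I" "I \<noteq> {}" and "\<And>i. i \<in> I \<Longrightarrow> exposes K (f i) x"
    and "\<And>i. i \<in> I \<Longrightarrow> c i > 0"
  shows "exposes K (\<Sum>i\<in>I. c i *\<^sub>R f i) x"
  using assms unfolding exposes_def inner_sum_right inner_scaleR_right
  by (auto intro!: sum_strict_mono)

text \<open>A point of \<open>K\<close> farthest from \<open>- R u\<close> is exposed by \<open>R u + x\<close>, a direction
  close to that of \<open>u\<close> for large \<open>R\<close>.\<close>

lemma exposing_directions_dense:
  fixes K :: "'a::euclidean_space set"
  assumes "compact K" "K \<noteq> {}" "e > 0"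
  shows "\<exists>w x. exposes K w x \<and> norm (w - u) < e"
proof -
  obtain M where M: "\<And>y. y \<in> K \<Longrightarrow> norm y \<le> M" "M > 0"
    using compact_imp_bounded[OF \<open>compact K\<close>] bounded_pos by metis
  \<comment> \<open>Makes \<open>M / R < e\<close>, so the correction
    \<open>(1 / R) *\<^sub>R x\<close> to \<open>u\<close> is shorter than \<open>e\<close>.\<close>
  define R where "R = (M + 1) / e"
  have "R > 0" using M \<open>e > 0\<close> by (simp add: R_def)
  \<comment> \<open>Up to a constant this is the squared distance of \<open>y\<close> from
    \<open>- R *\<^sub>R u\<close>.\<close>
  have "continuous_on K (\<lambda>y. 2 * R * (y \<bullet> u) + y \<bullet> y)" by (intro continuous_intros)
  from continuous_attains_sup[OF assms(1,2) this]
  obtain x where x: "x \<in> K"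
    "\<And>y. y \<in> K \<Longrightarrow> 2 * R * (y \<bullet> u) + y \<bullet> y \<le> 2 * R * (x \<bullet> u) + x \<bullet> x" by auto
  have "exposes K (u + (1 / R) *\<^sub>R x) x"
    unfolding exposes_def
  proof (intro conjI ballI impI)
    fix y assume y: "y \<in> K" "y \<noteq> x"
    have "0 < (y - x) \<bullet> (y - x)" using y by simp
    then have "0 < y \<bullet> y - 2 * (y \<bullet> x) + x \<bullet> x"
      by (simp add: inner_diff_left inner_diff_right inner_commute)
    with x(2)[OF y(1)] have "R * (y \<bullet> u) + y \<bullet> x < R * (x \<bullet> u) + x \<bullet> x" by linarith
    then have "R * (y \<bullet> (u + (1 / R) *\<^sub>R x)) < R * (x \<bullet> (u + (1 / R) *\<^sub>R x))"
      using \<open>R > 0\<close> by (simp add: inner_add_right algebra_simps)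
    then show "y \<bullet> (u + (1 / R) *\<^sub>R x) < x \<bullet> (u + (1 / R) *\<^sub>R x)"
      using \<open>R > 0\<close> by simp
  qed (rule x)
  moreover have "norm (u + (1 / R) *\<^sub>R x - u) < e"
  proof -
    have "norm x / R \<le> M / R" using M x \<open>R > 0\<close> by (simp add: divide_right_mono)
    also have "\<dots> < e" using \<open>e > 0\<close> M by (simp add: R_def field_simps)
    finally show ?thesis using \<open>R > 0\<close> by simp
  qed
  ultimately show ?thesis by blast
qed

text \<open>Outside the ball of radius \<open>\<eta>\<close> about \<open>x\<close>, compactness
  gives a gap \<open>g\<close> below the maximum in direction \<open>w\<close>. A perturbation
  smaller than \<open>g / (2 * M)\<close> changes each value on \<open>K\<close> by less than
  \<open>g / 2\<close>, too little for a point out there to overtake \<open>x\<close>.\<close>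

lemma exposes_stable:
  fixes K :: "'a::euclidean_space set"
  assumes "compact K" "exposes K w x" "\<eta> > 0"
  shows "\<exists>\<delta>>0. \<forall>u y. exposes K u y \<longrightarrow> norm (u - w) < \<delta> \<longrightarrow> dist y x < \<eta>"
proof -
  obtain M where M: "\<And>y. y \<in> K \<Longrightarrow> norm y \<le> M" "M > 0"
    using compact_imp_bounded[OF \<open>compact K\<close>] bounded_pos by metis
  have xK: "x \<in> K" using assms by (simp add: exposes_def)
  define C where "C = K - ball x \<eta>"
  have "compact C" unfolding C_def using assms by (simp add: compact_diff)
  have "\<exists>g>0. \<forall>y\<in>C. y \<bullet> w + g \<le> x \<bullet> w"
  proof (cases "C = {}")
    case False
    have "continuous_on C (\<lambda>y. y \<bullet> w)" by (intro continuous_intros)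
    from continuous_attains_sup[OF \<open>compact C\<close> False this]
    obtain z where z: "z \<in> C" "\<And>y. y \<in> C \<Longrightarrow> y \<bullet> w \<le> z \<bullet> w" by auto
    have "z \<bullet> w < x \<bullet> w" using z(1) assms unfolding C_def exposes_def by auto
    then show ?thesis using z by (intro exI[of _ "x \<bullet> w - z \<bullet> w"]) auto
  qed (auto intro: exI[of _ 1])
  then obtain g where g: "g > 0" "\<And>y. y \<in> C \<Longrightarrow> y \<bullet> w + g \<le> x \<bullet> w" by blast
  have "dist y x < \<eta>" if y: "exposes K u y" "norm (u - w) < g / (2 * M)" for u y
  proof (rule ccontr)
    assume "\<not> dist y x < \<eta>"
    then have yC: "y \<in> C" and "y \<noteq> x"
      using y \<open>\<eta> > 0\<close> by (auto simp: C_def exposes_def dist_commute)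
    then have lt: "x \<bullet> u < y \<bullet> u" using y xK by (auto simp: exposes_def)
    have bd: "\<bar>z \<bullet> (u - w)\<bar> < g / 2" if "z \<in> K" for z
    proof -
      have "\<bar>z \<bullet> (u - w)\<bar> \<le> norm z * norm (u - w)" by (rule Cauchy_Schwarz_ineq2)
      also have "\<dots> \<le> M * norm (u - w)" using M that by (intro mult_right_mono) auto
      also have "\<dots> < M * (g / (2 * M))" using M y by (intro mult_strict_left_mono) auto
      finally show ?thesis using M by simp
    qed
    have "y \<in> K" using yC by (simp add: C_def)
    then have "y \<bullet> u < y \<bullet> w + g / 2" "x \<bullet> w - g / 2 < x \<bullet> u"
      using bd[OF xK] bd[of y] unfolding inner_diff_right by linarith+
    then show False using g(2)[OF yC] lt by linarith
  qed
  then show ?thesis using g M by (intro exI[of _ "g / (2 * M)"]) auto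
qed

subsection \<open>Positively spanning sets and general position\<close>

text \<open>Dual form of positive spanning: no closed half-space bounded by a hyperplane through
  \<open>0\<close> contains \<open>S\<close>.\<close>

definition pos_spanning :: "'a::euclidean_space set \<Rightarrow> bool" where
  "pos_spanning S \<longleftrightarrow> (\<forall>v. v \<noteq> 0 \<longrightarrow> (\<exists>s\<in>S. s \<bullet> v > 0))"

text \<open>On the unit sphere the best inner product is bounded below by some \<open>e > 0\<close>;
  replacing a vector by one closer than \<open>e\<close> cannot cancel it.\<close>

lemma pos_spanning_stable:
  fixes S :: "'a::euclidean_space set"
  assumes "pos_spanning S"
  shows "\<exists>\<delta>>0. \<forall>S'. (\<forall>s\<in>S. \<exists>s'\<in>S'. norm (s' - s) < \<delta>) \<longrightarrow> pos_spanning S'"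
proof -
  have "\<exists>e>0. \<forall>v\<in>sphere (0::'a) 1. \<exists>s\<in>S. s \<bullet> v \<ge> e"
  proof (rule compact_uniform_eps)
    fix u :: 'a assume "u \<in> sphere 0 1"
    then obtain s where s: "s \<in> S" "s \<bullet> u > 0"
      using assms unfolding pos_spanning_def by (metis norm_zero zero_neq_one mem_sphere_0)
    have "open {v. s \<bullet> v > s \<bullet> u / 2}" by (intro open_Collect_less continuous_intros)
    moreover have "u \<in> {v. s \<bullet> v > s \<bullet> u / 2}" using s by simp
    ultimately obtain d where "d > 0" "ball u d \<subseteq> {v. s \<bullet> v > s \<bullet> u / 2}"
      using open_contains_ball_eq by metis
    then show "\<exists>d>0. \<exists>e>0. \<forall>v\<in>ball u d. \<exists>s\<in>S. e \<le> s \<bullet> v"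
      using s by (intro exI[of _ d] conjI exI[of _ "s \<bullet> u / 2"]) (auto intro!: bexI[of _ s])
  qed (auto, meson order_trans)
  then obtain e where e: "e > 0" "\<And>v::'a. norm v = 1 \<Longrightarrow> \<exists>s\<in>S. s \<bullet> v \<ge> e" by auto
  have "pos_spanning S'" if S': "\<forall>s\<in>S. \<exists>s'\<in>S'. norm (s' - s) < e" for S'
    unfolding pos_spanning_def
  proof (intro allI impI)
    fix v :: 'a assume "v \<noteq> 0"
    define z where "z = v /\<^sub>R norm v"
    have z: "norm z = 1" using \<open>v \<noteq> 0\<close> by (simp add: z_def)
    obtain s where s: "s \<in> S" "s \<bullet> z \<ge> e" using e(2)[OF z] by blast
    obtain s' where s': "s' \<in> S'" "norm (s' - s) < e" using S' s by blast
    have "\<bar>(s' - s) \<bullet> z\<bar> \<le> norm (s' - s) * norm z" by (rule Cauchy_Schwarz_ineq2)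
    then have "s' \<bullet> z > 0" using s s' z by (simp add: inner_diff_left)
    then have "s' \<bullet> v > 0" using \<open>v \<noteq> 0\<close> by (simp add: z_def zero_less_mult_iff)
    then show "\<exists>s\<in>S'. s \<bullet> v > 0" using s' by blast
  qed
  then show ?thesis using e by blast
qed

text \<open>Otherwise a hyperplane strictly separates \<open>0\<close> from the hull, giving a
  \<open>v\<close> with negative inner product with all of \<open>S\<close>.\<close>

lemma pos_spanning_imp_0_in_hull:
  fixes S :: "'a::euclidean_space set"
  assumes "finite S" "pos_spanning S"
  shows "0 \<in> convex hull S"
proof (rule ccontr)
  assume "0 \<notin> convex hull S"
  moreover have "closed (convex hull S)"
    using assms by (simp add: compact_convex_hull compact_imp_closed finite_imp_compact)
  ultimately obtain a b where ab: "a \<noteq> 0" "0 < b" "\<forall>x\<in>convex hull S. a \<bullet> x > b"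
    using separating_hyperplane_closed_0[OF convex_convex_hull] by metis
  then obtain s where "s \<in> S" "s \<bullet> (- a) > 0"
    using assms unfolding pos_spanning_def by (metis neg_equal_0_iff_equal)
  then show False using ab hull_inc[of s S convex] by (force simp: inner_commute)
qed

text \<open>If no inner product with \<open>v\<close> is positive, all of them vanish since they sum
  to zero; then \<open>v\<close> is orthogonal to the whole space.\<close>

lemma sum_zero_spanning_imp_pos_spanning:
  fixes W :: "'i \<Rightarrow> 'a::euclidean_space"
  assumes "finite F" "(\<Sum>x\<in>F. W x) = 0" "span (W ` F) = UNIV"
  shows "pos_spanning (W ` F)"
  unfolding pos_spanning_def
proof (intro allI impI, rule ccontr)
  fix v :: 'a assume v: "v \<noteq> 0" and "\<not> (\<exists>s\<in>W ` F. s \<bullet> v > 0)"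
  then have le: "W x \<bullet> v \<le> 0" if "x \<in> F" for x using that by force
  have "(\<Sum>x\<in>F. - (W x \<bullet> v)) = 0"
    using assms(2) by (simp add: sum_negf flip: inner_sum_left)
  then have "\<forall>x\<in>F. W x \<bullet> v = 0"
    using le assms(1) by (subst (asm) sum_nonneg_eq_0_iff) auto
  then have "orthogonal v s" if "s \<in> W ` F" for s
    using that by (auto simp: orthogonal_def inner_commute)
  then have "orthogonal v v" using orthogonal_to_span[of v "W ` F" v] assms(3) by simp
  then show False using v by (simp add: orthogonal_def)
qed

text \<open>A finite union of proper subspaces is closed and negligible, so it leaves a nonempty
  open part of every ball, which \<open>D\<close> meets.\<close>

lemma dense_avoids_subspaces:
  fixes D :: "'a::euclidean_space set"
  assumes dense: "\<And>u e. e > 0 \<Longrightarrow> \<exists>w\<in>D. norm (w - u) < e"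
    and "finite \<V>" "\<And>V. V \<in> \<V> \<Longrightarrow> subspace V \<and> dim V < DIM('a)" "e > 0"
  shows "\<exists>w\<in>D. norm (w - u) < e \<and> w \<notin> \<Union>\<V>"
proof -
  have "negligible (\<Union>\<V>)"
    using assms by (intro negligible_Union) (auto intro: negligible_lowdim)
  moreover have "\<not> negligible (ball u e)"
    using \<open>e > 0\<close> by (intro open_not_negligible) auto
  ultimately have "\<not> ball u e \<subseteq> \<Union>\<V>"
    using negligible_subset by blast
  then obtain z where z: "z \<in> ball u e - \<Union>\<V>" by blast
  have "open (ball u e - \<Union>\<V>)"
    using assms by (intro open_Diff open_ball closed_Union) (auto intro: closed_subspace)
  then obtain d where "d > 0" and d: "ball z d \<subseteq> ball u e - \<Union>\<V>"
    using z open_contains_ball by blast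
  obtain w where "w \<in> D" and "norm (w - z) < d" using dense \<open>d > 0\<close> by blast
  then have "w \<in> ball z d" by (simp add: dist_norm norm_minus_commute)
  then have "w \<in> ball u e - \<Union>\<V>" using d by blast
  then show ?thesis using \<open>w \<in> D\<close> by (auto simp: dist_norm norm_minus_commute)
qed

text \<open>The vectors are chosen one by one, each outside the finitely many proper subspaces
  spanned by fewer than \<open>DIM('a)\<close> earlier ones.\<close>

lemma general_position:
  fixes W :: "'i \<Rightarrow> 'a::euclidean_space"
  assumes dense: "\<And>u e. e > 0 \<Longrightarrow> \<exists>w\<in>D. norm (w - u) < e"
    and "finite F" "\<delta> > 0"
  shows "\<exists>W'. (\<forall>x\<in>F. W' x \<in> D \<and> norm (W' x - W x) < \<delta>) \<and>
    (\<forall>T\<subseteq>F. card T \<le> DIM('a) \<longrightarrow> inj_on W' T \<and> independent (W' ` T))"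
  using \<open>finite F\<close>
proof (induction F)
  case empty
  then show ?case by (auto simp: independent_empty)
next
  case (insert x F)
  then obtain W' where W': "\<forall>x\<in>F. W' x \<in> D \<and> norm (W' x - W x) < \<delta>"
    "\<And>T. T \<subseteq> F \<Longrightarrow> card T \<le> DIM('a) \<Longrightarrow> inj_on W' T \<and> independent (W' ` T)" by blast
  define \<V> where "\<V> = (\<lambda>T. span (W' ` T)) ` {T. T \<subseteq> F \<and> card T < DIM('a)}"
  have dimV: "dim (span (W' ` T)) < DIM('a)" if "T \<subseteq> F" "card T < DIM('a)" for T
  proof -
    have "finite T" using that insert finite_subset by blast
    then have "dim (W' ` T) \<le> card T"
      by (meson card_image_le dim_le_card' finite_imageI le_trans)
    then show ?thesis using that by simp
  qed
  have "finite \<V>" unfolding \<V>_def using insert by simp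
  moreover have "subspace V \<and> dim V < DIM('a)" if "V \<in> \<V>" for V
    using that dimV unfolding \<V>_def by auto
  ultimately have "\<exists>w\<in>D. norm (w - W x) < \<delta> \<and> w \<notin> \<Union>\<V>"
    using dense_avoids_subspaces[OF dense _ _ \<open>\<delta> > 0\<close>] by blast
  then obtain w where w: "w \<in> D" "norm (w - W x) < \<delta>" "w \<notin> \<Union>\<V>" by blast
  define W'' where "W'' = W'(x := w)"
  have eq: "W'' y = W' y" if "y \<in> F" for y using that insert by (auto simp: W''_def)
  have "inj_on W'' T \<and> independent (W'' ` T)" if T: "T \<subseteq> insert x F" "card T \<le> DIM('a)" for T
  proof (cases "x \<in> T")
    case False
    then have "T \<subseteq> F" using T by auto
    then show ?thesis
      using W'(2)[OF _ T(2)] eq by (metis (no_types, lifting) image_cong inj_on_cong subsetD)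
  next
    case True
    define T' where "T' = T - {x}"
    have T': "T' \<subseteq> F" "T = insert x T'" "x \<notin> T'" using T True by (auto simp: T'_def)
    have "finite T'" using T' insert finite_subset by blast
    then have c: "card T' < DIM('a)" using T T' by simp
    have im: "W'' ` T' = W' ` T'" using eq T' by (metis (no_types, lifting) image_cong subsetD)
    have ind: "inj_on W' T'" "independent (W' ` T')" using W'(2)[of T'] T' c by auto
    have "inj_on W'' T'" using ind eq T' by (metis (no_types, lifting) inj_on_cong subsetD)
    have "w \<notin> span (W' ` T')" using w c T' unfolding \<V>_def by blast
    then have "independent (insert w (W' ` T'))" "w \<notin> W' ` T'"
      using ind by (auto simp: independent_insert span_base)
    then show ?thesis
      using T' im \<open>inj_on W'' T'\<close> insert by (auto simp: W''_def)
  qed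
  moreover have "\<forall>y\<in>insert x F. W'' y \<in> D \<and> norm (W'' y - W y) < \<delta>"
    using W'(1) w by (auto simp: W''_def)
  ultimately show ?case by (intro exI[of _ W'']) blast
qed

subsection \<open>Choosing the facet normals\<close>

text \<open>Exposing directions of the same point can be added up, so a positive dependency between
  exposing directions yields one with pairwise distinct exposed points.\<close>

lemma zero_sum_exposing_family:
  fixes K :: "'a::euclidean_space set"
  assumes "compact K" "finite E" "E \<noteq> {}" and w: "\<And>x. x \<in> E \<Longrightarrow> exposes K (w x) x"
  shows "\<exists>F W. finite F \<and> E \<subseteq> F \<and> (\<forall>x\<in>F. exposes K (W x) x) \<and> (\<Sum>x\<in>F. W x) = 0"
proof -
  have "K \<noteq> {}" using \<open>E \<noteq> {}\<close> w by (auto simp: exposes_def)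
  define C where "C = (Basis :: 'a set) \<union> uminus ` Basis"
  have "finite C" by (simp add: C_def)
  have "pos_spanning C"
    unfolding pos_spanning_def
  proof (intro allI impI)
    fix v :: 'a assume "v \<noteq> 0"
    then obtain b where b: "b \<in> Basis" "v \<bullet> b \<noteq> 0" using euclidean_all_zero_iff by blast
    show "\<exists>s\<in>C. s \<bullet> v > 0"
    proof (cases "v \<bullet> b > 0")
      case True
      then show ?thesis using b by (intro bexI[of _ b]) (auto simp: C_def inner_commute)
    next
      case False
      then show ?thesis using b by (intro bexI[of _ "- b"]) (auto simp: C_def inner_commute)
    qed
  qed
  then obtain \<delta> where \<delta>: "\<delta> > 0"
    "\<And>S'. (\<And>s. s \<in> C \<Longrightarrow> \<exists>s'\<in>S'. norm (s' - s) < \<delta>) \<Longrightarrow> pos_spanning S'"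
    using pos_spanning_stable[of C] by blast
  define V where "V = (\<Sum>x\<in>E. w x)"
  \<comment> \<open>Half of \<open>\<delta>\<close> is reserved for the shift by
    \<open>\<epsilon> *\<^sub>R V\<close>, the other half for approximating \<open>C\<close> by
    exposing directions; the \<open>+ 1\<close> allows \<open>V = 0\<close>.\<close>
  define \<epsilon> where "\<epsilon> = \<delta> / 2 / (norm V + 1)"
  have "\<epsilon> > 0" using \<delta> by (simp add: \<epsilon>_def add_nonneg_pos)
  have "norm V + 1 > 0" by (simp add: add_nonneg_pos)
  then have "\<epsilon> * (norm V + 1) = \<delta> / 2"
    unfolding \<epsilon>_def by (metis less_irrefl nonzero_eq_divide_eq)
  then have "\<epsilon> * norm V \<le> \<delta> / 2" using \<open>\<epsilon> > 0\<close> by (simp add: distrib_left)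
  have "\<forall>s\<in>C. \<exists>b. (\<exists>x. exposes K b x) \<and> norm (b - s) < \<delta> / 2"
    using exposing_directions_dense[OF \<open>compact K\<close> \<open>K \<noteq> {}\<close>] \<delta> by (meson half_gt_zero)
  then obtain c where c: "\<And>s. s \<in> C \<Longrightarrow> (\<exists>x. exposes K (c s) x) \<and> norm (c s - s) < \<delta> / 2"
    by metis
  define B where "B = c ` C"
  have "finite B" using \<open>finite C\<close> by (simp add: B_def)
  have "pos_spanning ((\<lambda>b. \<epsilon> *\<^sub>R V + b) ` B)"
  proof (rule \<delta>(2))
    fix s assume "s \<in> C"
    have "norm (\<epsilon> *\<^sub>R V + c s - s) \<le> norm (\<epsilon> *\<^sub>R V) + norm (c s - s)"
      by (metis add_diff_eq norm_triangle_ineq)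
    also have "\<dots> < \<delta>"
      using c[OF \<open>s \<in> C\<close>] \<open>\<epsilon> * norm V \<le> \<delta> / 2\<close> \<open>\<epsilon> > 0\<close> by simp
    finally show "\<exists>s'\<in>(\<lambda>b. \<epsilon> *\<^sub>R V + b) ` B. norm (s' - s) < \<delta>"
      using \<open>s \<in> C\<close> by (auto simp: B_def)
  qed
  then have "0 \<in> convex hull ((\<lambda>b. \<epsilon> *\<^sub>R V + b) ` B)"
    using pos_spanning_imp_0_in_hull \<open>finite B\<close> by blast
  then have "- (\<epsilon> *\<^sub>R V) \<in> convex hull B"
    unfolding convex_hull_translation
    by (metis add_eq_0_iff image_iff)
  then obtain a where a: "\<And>b. b \<in> B \<Longrightarrow> a b \<ge> 0" "(\<Sum>b\<in>B. a b *\<^sub>R b) = - (\<epsilon> *\<^sub>R V)"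
    unfolding convex_hull_finite[OF \<open>finite B\<close>] by auto
  have "\<forall>b\<in>B \<union> w ` E. \<exists>x. exposes K b x" using c w by (fastforce simp: B_def)
  then obtain p where p: "\<And>b. b \<in> B \<union> w ` E \<Longrightarrow> exposes K b (p b)" by metis
  have pw: "p (w x) = x" if "x \<in> E" for x using p w that exposes_unique by blast
  then have "inj_on w E" by (metis inj_onI)
  \<comment> \<open>Coefficients of the dependency obtained by moving
    \<open>\<epsilon> *\<^sub>R V\<close> to the other side. They are added because a vector may
    come both from \<open>B\<close> and from \<open>E\<close>; each \<open>w x\<close> gets weight
    at least \<open>\<epsilon>\<close>, which ensures \<open>E \<subseteq> F\<close>.\<close>
  define \<mu> where "\<mu> b = (if b \<in> B then a b else 0) + (if b \<in> w ` E then \<epsilon> else 0)" for b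
  define U where "U = {b \<in> B \<union> w ` E. \<mu> b > 0}"
  have "finite U" using \<open>finite B\<close> \<open>finite E\<close> by (simp add: U_def)
  have sumU: "(\<Sum>b\<in>U. \<mu> b *\<^sub>R b) = 0"
  proof -
    have "(\<Sum>b\<in>U. \<mu> b *\<^sub>R b) = (\<Sum>b\<in>B \<union> w ` E. \<mu> b *\<^sub>R b)"
      using \<open>finite B\<close> \<open>finite E\<close> a(1) \<open>\<epsilon> > 0\<close>
      by (intro sum.mono_neutral_left) (fastforce simp: U_def \<mu>_def)+
    also have "\<dots> = (\<Sum>b\<in>B \<union> w ` E. (if b \<in> B then a b *\<^sub>R b else 0)) +
        (\<Sum>b\<in>B \<union> w ` E. (if b \<in> w ` E then \<epsilon> *\<^sub>R b else 0))"
      unfolding sum.distrib[symmetric] by (intro sum.cong) (auto simp: \<mu>_def scaleR_add_left)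
    also have "(\<Sum>b\<in>B \<union> w ` E. (if b \<in> B then a b *\<^sub>R b else 0)) = (\<Sum>b\<in>B. a b *\<^sub>R b)"
      using \<open>finite B\<close> \<open>finite E\<close> by (intro sum.mono_neutral_cong_right) auto
    also have "(\<Sum>b\<in>B \<union> w ` E. (if b \<in> w ` E then \<epsilon> *\<^sub>R b else 0)) = (\<Sum>b\<in>w ` E. \<epsilon> *\<^sub>R b)"
      using \<open>finite B\<close> \<open>finite E\<close> by (intro sum.mono_neutral_cong_right) auto
    also have "\<dots> = \<epsilon> *\<^sub>R V"
      using \<open>inj_on w E\<close> by (simp add: V_def sum.reindex scaleR_sum_right)
    finally show ?thesis using a(2) by simp
  qed
  define F where "F = p ` U"
  define W where "W x = (\<Sum>b\<in>{b \<in> U. p b = x}. \<mu> b *\<^sub>R b)" for x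
  have "finite F" using \<open>finite U\<close> by (simp add: F_def)
  moreover have "E \<subseteq> F"
  proof
    fix x assume x: "x \<in> E"
    have "w x \<in> U" using x a(1) \<open>\<epsilon> > 0\<close> by (auto simp: U_def \<mu>_def add_nonneg_pos)
    then show "x \<in> F" using pw[OF x] unfolding F_def by (metis imageI)
  qed
  moreover have "\<forall>x\<in>F. exposes K (W x) x"
  proof
    fix x assume "x \<in> F"
    show "exposes K (W x) x" unfolding W_def
    proof (rule exposes_sum_scaled)
      show "{b \<in> U. p b = x} \<noteq> {}" using \<open>x \<in> F\<close> by (auto simp: F_def)
      show "exposes K b x" if "b \<in> {b \<in> U. p b = x}" for b
        using that p[of b] by (auto simp del: Un_iff simp: U_def)
      show "finite {b \<in> U. p b = x}" using \<open>finite U\<close> by simp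
    qed (simp add: U_def)
  qed
  moreover have "(\<Sum>x\<in>F. W x) = 0"
    using sumU sum.image_gen[OF \<open>finite U\<close>, of "\<lambda>b. \<mu> b *\<^sub>R b" p] by (simp add: F_def W_def)
  ultimately show ?thesis by blast
qed

text \<open>The zero-sum family is perturbed twice: first to make it span with sum still zero, hence
  positively span, then to get exposing directions in general position. All stay so close to
  \<open>W\<close> that the exposed points remain near distinct points of \<open>F\<close>, which
  gives injectivity of \<open>p\<close>.\<close>

lemma exposing_simplex_normals:
  fixes K :: "'a::euclidean_space set"
  assumes "compact K" "finite E" "card E = DIM('a) + 1"
    and "\<And>x. x \<in> E \<Longrightarrow> exposed_point K x"
  obtains S a p where "finite S" "card S = DIM('a) + 1"
    "\<And>T. T \<subseteq> S \<Longrightarrow> card T \<le> DIM('a) \<Longrightarrow> independent T"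
    "\<And>s. s \<in> S \<Longrightarrow> a s > (0::real)" "(\<Sum>s\<in>S. a s *\<^sub>R s) = 0"
    "inj_on p S" "\<And>s. s \<in> S \<Longrightarrow> exposes K s (p s)"
proof -
  have "E \<noteq> {}" using assms by auto
  then have "K \<noteq> {}" using assms(4) by (auto simp: exposed_point_def)
  obtain w where "\<And>x. x \<in> E \<Longrightarrow> exposes K (w x) x"
    using exposed_point_exposes assms(4) by metis
  from zero_sum_exposing_family[OF \<open>compact K\<close> \<open>finite E\<close> \<open>E \<noteq> {}\<close> this]
  obtain F W where F: "finite F" "E \<subseteq> F" "\<And>x. x \<in> F \<Longrightarrow> exposes K (W x) x" "(\<Sum>x\<in>F. W x) = 0"
    by blast
  have cardF: "DIM('a) + 1 \<le> card F" using F assms card_mono by metis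
  \<comment> \<open>With this separation no point is within \<open>\<eta>\<close> of two different
    points of \<open>F\<close>.\<close>
  obtain \<eta> where \<eta>: "\<eta> > 0" "\<And>x y. x \<in> F \<Longrightarrow> y \<in> F \<Longrightarrow> x \<noteq> y \<Longrightarrow> 2 * \<eta> \<le> dist x y"
  proof -
    obtain d where d: "d > 0" "\<And>x y. x \<in> F \<Longrightarrow> y \<in> F \<Longrightarrow> x \<noteq> y \<Longrightarrow> d \<le> dist x y"
    proof -
      have "\<forall>x\<in>F. \<exists>d>0. \<forall>y\<in>F. y \<noteq> x \<longrightarrow> d \<le> dist x y"
        using finite_set_avoid[OF F(1)] by (metis dist_commute)
      then obtain d where d: "\<And>x. x \<in> F \<Longrightarrow> d x > 0 \<and> (\<forall>y\<in>F. y \<noteq> x \<longrightarrow> d x \<le> dist x y)"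
        by metis
      have "Min (insert 1 (d ` F)) > 0" using F(1) d by (subst Min_gr_iff) auto
      moreover have "Min (insert 1 (d ` F)) \<le> dist x y" if "x \<in> F" "y \<in> F" "x \<noteq> y" for x y
        using d[OF that(1)] that F(1) by (intro order_trans[OF Min_le, of _ "d x"]) auto
      ultimately show ?thesis using that by blast
    qed
    then show ?thesis using that[of "d / 2"] by simp
  qed
  obtain \<delta>1 where \<delta>1: "\<delta>1 > 0"
    "\<And>x u y. x \<in> F \<Longrightarrow> exposes K u y \<Longrightarrow> norm (u - W x) < \<delta>1 \<Longrightarrow> dist y x < \<eta>"
  proof -
    have "\<forall>x\<in>F. \<exists>\<delta>>0. \<forall>u y. exposes K u y \<longrightarrow> norm (u - W x) < \<delta> \<longrightarrow> dist y x < \<eta>"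
      using exposes_stable[OF \<open>compact K\<close> F(3) \<eta>(1)] by blast
    then obtain d where d: "\<And>x. x \<in> F \<Longrightarrow> d x > 0 \<and>
        (\<forall>u y. exposes K u y \<longrightarrow> norm (u - W x) < d x \<longrightarrow> dist y x < \<eta>)" by metis
    have "Min (insert 1 (d ` F)) > 0" using F(1) d by (subst Min_gr_iff) auto
    moreover have "Min (insert 1 (d ` F)) \<le> d x" if "x \<in> F" for x
      using that F(1) by (intro Min_le) auto
    ultimately show ?thesis using that d by (meson order_less_le_trans)
  qed
  obtain x0 where x0: "x0 \<in> F" using F \<open>E \<noteq> {}\<close> by blast
  define F0 where "F0 = F - {x0}"
  have F0: "finite F0" "F = insert x0 F0" "x0 \<notin> F0" using F x0 by (auto simp: F0_def)
  \<comment> \<open>The vector at \<open>x0\<close> absorbs the changes of all others, so these may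
    add up to at most \<open>\<delta>1 / 2\<close>.\<close>
  define \<delta>2 where "\<delta>2 = \<delta>1 / (2 * card F)"
  have cF: "real (card F) \<ge> 1" using cardF by simp
  have "\<delta>2 > 0" using \<delta>1 cF by (simp add: \<delta>2_def)
  text \<open>The last vector is adjusted to keep the sum zero; since at least \<open>DIM('a)\<close> others are in
    general position, the new family spans and is hence positively spanning.\<close>
  obtain W1 where W1: "\<And>x. x \<in> F0 \<Longrightarrow> norm (W1 x - W x) < \<delta>2"
    "\<And>T. T \<subseteq> F0 \<Longrightarrow> card T \<le> DIM('a) \<Longrightarrow> inj_on W1 T \<and> independent (W1 ` T)"
  proof -
    have "\<exists>w\<in>UNIV. norm (w - u) < e" if "e > 0" for u :: 'a and e
      using that by (intro bexI[of _ u]) auto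
    from general_position[OF this F0(1) \<open>\<delta>2 > 0\<close>, of W] show ?thesis using that by blast
  qed
  define W2 where "W2 x = (if x = x0 then - (\<Sum>x\<in>F0. W1 x) else W1 x)" for x
  have W2: "W2 x = W1 x" if "x \<in> F0" for x using that F0 by (auto simp: W2_def)
  have sum2: "(\<Sum>x\<in>F. W2 x) = 0"
    using F0 W2 by (simp add: W2_def[of x0])
  have span2: "span (W2 ` F) = UNIV"
  proof -
    have "DIM('a) \<le> card F0" using cardF F0 by simp
    then obtain T where T: "T \<subseteq> F0" "card T = DIM('a)" by (meson obtain_subset_with_card_n)
    then have T': "inj_on W1 T" "independent (W1 ` T)" using W1(2)[of T] by auto
    then have "UNIV \<subseteq> span (W1 ` T)"
      using T by (intro card_ge_dim_independent) (auto simp: card_image)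
    moreover have "W1 ` T \<subseteq> W2 ` F" using W2 T F0 by force
    ultimately show ?thesis using span_mono by blast
  qed
  have "pos_spanning (W2 ` F)"
    by (rule sum_zero_spanning_imp_pos_spanning[OF F(1) sum2 span2])
  from pos_spanning_stable[OF this]
  obtain \<delta>3 where \<delta>3: "\<delta>3 > 0"
    "\<forall>S'. (\<forall>s\<in>W2 ` F. \<exists>s'\<in>S'. norm (s' - s) < \<delta>3) \<longrightarrow> pos_spanning S'" by (elim exE conjE)
  have near2: "norm (W2 x - W x) \<le> \<delta>1 / 2" if "x \<in> F" for x
  proof (cases "x = x0")
    case True
    have W0: "W x0 = - (\<Sum>x\<in>F0. W x)" using F(4) F0 by (simp add: add_eq_0_iff2)
    have "norm (W2 x - W x) = norm (\<Sum>x\<in>F0. W x - W1 x)"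
      using True W0 by (simp add: W2_def sum_subtractf)
    also have "\<dots> \<le> (\<Sum>x\<in>F0. \<delta>2)"
      using W1(1) by (intro sum_norm_le) (simp add: norm_minus_commute less_imp_le)
    also have "\<dots> \<le> card F * \<delta>2" using F0 \<open>\<delta>2 > 0\<close> by simp
    finally show ?thesis using cF by (simp add: \<delta>2_def)
  next
    case False
    then have "x \<in> F0" using that F0 by auto
    have "norm (W2 x - W x) \<le> \<delta>2" using W1(1)[OF \<open>x \<in> F0\<close>] W2[OF \<open>x \<in> F0\<close>] by simp
    also have "\<delta>2 \<le> \<delta>1 / 2" using cF \<delta>1(1) by (simp add: \<delta>2_def field_simps)
    finally show ?thesis .
  qed
  \<comment> \<open>The vectors \<open>W2 x\<close> need not expose anything, so they are moved once
    more, into \<open>D\<close>: by less than \<open>\<delta>3\<close> to keep positive spanning and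
    by less than \<open>\<delta>1 / 2\<close> to stay within \<open>\<delta>1\<close> of
    \<open>W\<close>.\<close>
  define D where "D = {u. \<exists>x. exposes K u x}"
  have "\<exists>w\<in>D. norm (w - u) < e" if "e > 0" for u :: 'a and e
    using exposing_directions_dense[OF \<open>compact K\<close> \<open>K \<noteq> {}\<close> that] unfolding D_def by blast
  from general_position[OF this F(1), of "min \<delta>3 (\<delta>1 / 2)" W2]
  obtain W3 where W3: "\<And>x. x \<in> F \<Longrightarrow> W3 x \<in> D \<and> norm (W3 x - W2 x) < min \<delta>3 (\<delta>1 / 2)"
    "\<And>T. T \<subseteq> F \<Longrightarrow> card T \<le> DIM('a) \<Longrightarrow> inj_on W3 T \<and> independent (W3 ` T)"
    using \<delta>1(1) \<delta>3(1) by (metis half_gt_zero min_less_iff_conj)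
  have "pos_spanning (W3 ` F)" using W3(1) by (intro \<delta>3(2)[rule_format]) force
  then have "0 \<in> convex hull (W3 ` F)" using pos_spanning_imp_0_in_hull F(1) by blast
  then obtain S0 a where S0: "finite S0" "S0 \<subseteq> W3 ` F" "card S0 \<le> DIM('a) + 1"
    "\<And>s. s \<in> S0 \<Longrightarrow> 0 \<le> a s" "sum a S0 = 1" "(\<Sum>s\<in>S0. a s *\<^sub>R s) = 0"
    unfolding convex_hull_caratheodory by auto
  define S where "S = {s \<in> S0. a s > 0}"
  have "finite S" "S \<subseteq> W3 ` F" using S0 by (auto simp: S_def)
  have apos: "a s > 0" if "s \<in> S" for s using that by (simp add: S_def)
  have zero: "(\<Sum>s\<in>S. a s *\<^sub>R s) = 0"
  proof -
    have "(\<Sum>s\<in>S. a s *\<^sub>R s) = (\<Sum>s\<in>S0. a s *\<^sub>R s)"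
      using S0(1,4) by (intro sum.mono_neutral_left) (fastforce simp: S_def)+
    then show ?thesis using S0 by simp
  qed
  have "S \<noteq> {}"
  proof
    assume "S = {}"
    then have "sum a S0 = 0" using S0(4) by (intro sum.neutral) (force simp: S_def)
    then show False using S0(5) by simp
  qed
  have ind: "independent T" if T: "T \<subseteq> S" "card T \<le> DIM('a)" for T
  proof -
    \<comment> \<open>General position is stated for index sets, so \<open>T\<close> is first lifted
      to one of the same cardinality.\<close>
    obtain T' where "T' \<subseteq> F" "T = W3 ` T'" "inj_on W3 T'"
      using T \<open>S \<subseteq> W3 ` F\<close> by (metis order_trans subset_image_inj)
    then show ?thesis using W3(2)[of T'] T by (simp add: card_image)
  qed
  \<comment> \<open>Caratheodory bounds the cardinality above; with fewer vectors \<open>S\<close>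
    would be independent, against the positive dependency.\<close>
  have "\<not> card S \<le> DIM('a)"
  proof
    assume "card S \<le> DIM('a)"
    then have "independent S" using ind by blast
    then have "\<forall>s\<in>S. a s = 0" using zero \<open>finite S\<close> independent_explicit_finite_subsets by blast
    then show False using apos \<open>S \<noteq> {}\<close> by force
  qed
  then have "card S = DIM('a) + 1"
    using S0(1,3) card_mono[of S0 S] by (force simp: S_def)
  have "\<forall>s\<in>S. \<exists>x. exposes K s x"
    using \<open>S \<subseteq> W3 ` F\<close> W3(1) unfolding D_def by blast
  then obtain p where p: "\<And>s. s \<in> S \<Longrightarrow> exposes K s (p s)" by metis
  have "inj_on p S"
  proof (rule inj_onI)
    fix s t assume st: "s \<in> S" "t \<in> S" "p s = p t"
    obtain x y where xy: "x \<in> F" "y \<in> F" "s = W3 x" "t = W3 y" using st \<open>S \<subseteq> W3 ` F\<close> by blast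
    have near: "norm (W3 z - W z) < \<delta>1" if "z \<in> F" for z
    proof -
      have "norm (W3 z - W z) \<le> norm (W3 z - W2 z) + norm (W2 z - W z)"
        using norm_triangle_ineq[of "W3 z - W2 z" "W2 z - W z"] by simp
      then show ?thesis using W3(1)[OF that] near2[OF that] by simp
    qed
    have "dist (p s) x < \<eta>" "dist (p s) y < \<eta>"
      using \<delta>1(2) near p st xy by metis+
    then have "dist x y < 2 * \<eta>" using dist_triangle_less_add[of x "p s" \<eta> y \<eta>] by (simp add: dist_commute)
    then have "x = y" using \<eta>(2) xy by force
    then show "s = t" using xy by simp
  qed
  then show ?thesis
    using that \<open>finite S\<close> \<open>card S = DIM('a) + 1\<close> ind apos zero p by blast
qed

subsection \<open>Simplices given by facet normals\<close>

text \<open>Outer facet normals of a simplex, with lengths left free; the weights \<open>a\<close>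
  form their positive linear dependency.\<close>

locale simplex_normals =
  fixes S :: "'a::euclidean_space set" and a :: "'a \<Rightarrow> real"
  assumes finite_S: "finite S" and card_S: "card S = DIM('a) + 1"
    and independent_S: "\<And>T. T \<subseteq> S \<Longrightarrow> card T \<le> DIM('a) \<Longrightarrow> independent T"
    and a_pos: "\<And>s. s \<in> S \<Longrightarrow> a s > 0"
    and sum_zero: "(\<Sum>s\<in>S. a s *\<^sub>R s) = 0"
begin

lemma S_nonempty: "S \<noteq> {}"
  using card_S by auto

lemma sum_a_pos: "sum a S > 0"
  using finite_S S_nonempty a_pos by (simp add: sum_pos)

lemma sum_inner_zero: "(\<Sum>s\<in>S. a s * (y \<bullet> s)) = 0"
  using arg_cong[OF sum_zero, of "\<lambda>v. y \<bullet> v"] by (simp add: inner_sum_right)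

lemma span_S: "span S = UNIV"
proof -
  obtain s where "s \<in> S" using S_nonempty by blast
  then have c: "card (S - {s}) = DIM('a)" using card_S finite_S by simp
  then have "UNIV \<subseteq> span (S - {s})"
    using independent_S[of "S - {s}"] by (intro card_ge_dim_independent) auto
  then show ?thesis using span_mono[of "S - {s}" S] by blast
qed

lemma eq_if_inner_eq:
  assumes "\<And>s. s \<in> S \<Longrightarrow> x \<bullet> s = y \<bullet> s"
  shows "x = y"
proof -
  have "orthogonal (x - y) s" if "s \<in> S" for s
    using assms[OF that] by (simp add: orthogonal_def inner_diff_left)
  then have "orthogonal (x - y) (x - y)"
    using orthogonal_to_span[of "x - y" S "x - y"] span_S by simp
  then show ?thesis by (simp add: orthogonal_def)
qed

text \<open>All but one of the normals are independent, so their equations can be solved; the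
  remaining equation follows from the dependency and the condition on \<open>g\<close>.\<close>

lemma solve_inner:
  assumes g: "(\<Sum>s\<in>S. a s * g s) = 0"
  obtains y where "\<And>s. s \<in> S \<Longrightarrow> y \<bullet> s = g s"
proof -
  obtain s0 where s0: "s0 \<in> S" using S_nonempty by blast
  then have "card (S - {s0}) = DIM('a)" using card_S finite_S by simp
  then have "independent (S - {s0})" using independent_S[of "S - {s0}"] by auto
  then obtain f :: "'a \<Rightarrow> real" where f: "linear f" "\<And>s. s \<in> S - {s0} \<Longrightarrow> f s = g s"
    using linear_independent_extend[of "S - {s0}" g] by blast
  \<comment> \<open>The vector representing the functional \<open>f\<close>.\<close>
  define y where "y = adjoint f 1"
  have y: "y \<bullet> v = f v" for v
    using adjoint_works[OF f(1), of v 1] unfolding y_def inner_commute[of "adjoint f 1"] by simp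
  have "a s0 * (y \<bullet> s0) = - (\<Sum>s\<in>S - {s0}. a s * (y \<bullet> s))"
    using sum_inner_zero[of y] finite_S s0 by (simp add: sum.remove)
  also have "\<dots> = - (\<Sum>s\<in>S - {s0}. a s * g s)" using f y by simp
  also have "\<dots> = a s0 * g s0" using g finite_S s0 by (simp add: sum.remove)
  finally have "y \<bullet> s0 = g s0" using a_pos[OF s0] by simp
  moreover have "y \<bullet> s = g s" if "s \<in> S" "s \<noteq> s0" for s using f(2)[of s] y that by simp
  ultimately show ?thesis using that by blast
qed

text \<open>The vertex \<open>v s\<close> lies on every bounding hyperplane except that of
  \<open>s\<close>, where its slack is \<open>\<rho> * A / a s\<close>. Dividing the slacks of a
  point by these gives its barycentric coordinates.\<close>

lemma simplex_halfspaces: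
  assumes "(\<Sum>s\<in>S. a s * g s) > 0"
  shows "int DIM('a) simplex {y. \<forall>s\<in>S. y \<bullet> s \<le> g s}"
proof -
  define A where "A = sum a S"
  \<comment> \<open>The weighted mean of the bounds; lowering the single bound of \<open>s\<close>
    by \<open>\<rho> * A / a s\<close> makes the weighted sum zero, as \<open>solve_inner\<close>
    requires.\<close>
  define \<rho> where "\<rho> = (\<Sum>s\<in>S. a s * g s) / A"
  have "A > 0" using sum_a_pos by (simp add: A_def)
  then have "\<rho> > 0" using assms by (simp add: \<rho>_def)
  have "\<exists>v. \<forall>r\<in>S. v \<bullet> r = g r - (if r = s then \<rho> * A / a s else 0)" if "s \<in> S" for s
  proof -
    have "(\<Sum>r\<in>S. a r * (g r - (if r = s then \<rho> * A / a s else 0))) =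
        (\<Sum>r\<in>S. a r * g r) - (\<Sum>r\<in>S. if r = s then \<rho> * A else 0)"
      unfolding sum_subtractf[symmetric] using a_pos[OF that]
      by (intro sum.cong) (auto simp: algebra_simps)
    also have "\<dots> = 0" using that finite_S \<open>A > 0\<close> by (simp add: \<rho>_def)
    finally show ?thesis by (rule solve_inner) blast
  qed
  then obtain v where v: "\<And>s r. s \<in> S \<Longrightarrow> r \<in> S \<Longrightarrow>
      v s \<bullet> r = g r - (if r = s then \<rho> * A / a s else 0)" by metis
  have comb: "(\<Sum>s\<in>S. c s *\<^sub>R v s) \<bullet> r = sum c S * g r - c r * (\<rho> * A / a r)"
    if "r \<in> S" for r c
  proof -
    have "(\<Sum>s\<in>S. c s *\<^sub>R v s) \<bullet> r = (\<Sum>s\<in>S. c s * g r - (if r = s then c s * (\<rho> * A / a s) else 0))"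
      unfolding inner_sum_left using that by (intro sum.cong) (auto simp: v right_diff_distrib)
    then show ?thesis
      using that finite_S by (simp add: sum_subtractf sum_distrib_right)
  qed
  have "inj_on v S"
  proof (rule inj_onI, rule ccontr)
    fix s t assume st: "s \<in> S" "t \<in> S" "v s = v t" "s \<noteq> t"
    then have "\<rho> * A / a s = 0" using v[of s s] v[of t s] by auto
    then show False using \<open>\<rho> > 0\<close> \<open>A > 0\<close> a_pos[OF st(1)] by simp
  qed
  have "\<not> affine_dependent (v ` S)"
  proof
    assume "affine_dependent (v ` S)"
    then obtain U where U: "sum U (v ` S) = 0" "\<exists>x\<in>v ` S. U x \<noteq> 0" "(\<Sum>x\<in>v ` S. U x *\<^sub>R x) = 0"
      using affine_dependent_explicit_finite[of "v ` S"] finite_S by auto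
    then have U': "(\<Sum>s\<in>S. U (v s)) = 0" "(\<Sum>s\<in>S. U (v s) *\<^sub>R v s) = 0"
      using \<open>inj_on v S\<close> by (simp_all add: sum.reindex)
    have "U (v r) = 0" if "r \<in> S" for r
      using comb[OF that, of "\<lambda>s. U (v s)"] U' \<open>\<rho> > 0\<close> \<open>A > 0\<close> a_pos[OF that] by simp
    then show False using U(2) by blast
  qed
  moreover have "int (card (v ` S)) = int DIM('a) + 1"
    using \<open>inj_on v S\<close> card_S by (simp add: card_image)
  moreover have "{y. \<forall>s\<in>S. y \<bullet> s \<le> g s} = convex hull (v ` S)"
  proof (intro equalityI subsetI)
    fix y assume "y \<in> {y. \<forall>s\<in>S. y \<bullet> s \<le> g s}"
    then have y: "\<And>s. s \<in> S \<Longrightarrow> y \<bullet> s \<le> g s" by blast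
    define c where "c s = (g s - y \<bullet> s) * a s / (\<rho> * A)" for s
    have c0: "c s \<ge> 0" if "s \<in> S" for s
      using y[OF that] a_pos[OF that] \<open>\<rho> > 0\<close> \<open>A > 0\<close> by (simp add: c_def)
    have "(\<Sum>s\<in>S. (g s - y \<bullet> s) * a s) = (\<Sum>s\<in>S. a s * g s) - (\<Sum>s\<in>S. a s * (y \<bullet> s))"
      by (simp add: algebra_simps sum_subtractf)
    then have "(\<Sum>s\<in>S. (g s - y \<bullet> s) * a s) = \<rho> * A"
      using sum_inner_zero[of y] \<open>A > 0\<close> by (simp add: \<rho>_def)
    then have c1: "sum c S = 1"
      using \<open>\<rho> > 0\<close> \<open>A > 0\<close> by (simp add: c_def flip: sum_divide_distrib)
    have "y = (\<Sum>s\<in>S. c s *\<^sub>R v s)"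
    proof (rule eq_if_inner_eq)
      fix r assume r: "r \<in> S"
      show "y \<bullet> r = (\<Sum>s\<in>S. c s *\<^sub>R v s) \<bullet> r"
        unfolding comb[OF r] c1 using a_pos[OF r] \<open>\<rho> > 0\<close> \<open>A > 0\<close> by (simp add: c_def)
    qed
    then show "y \<in> convex hull (v ` S)"
      using c0 c1 finite_S convex_sum[of S "convex hull (v ` S)" c v] by (simp add: hull_inc)
  next
    fix y assume y: "y \<in> convex hull (v ` S)"
    have eq: "{y. \<forall>s\<in>S. y \<bullet> s \<le> g s} = (\<Inter>s\<in>S. {y. s \<bullet> y \<le> g s})" by (auto simp: inner_commute)
    have "convex {y. \<forall>s\<in>S. y \<bullet> s \<le> g s}"
      unfolding eq by (intro convex_INT convex_halfspace_le)
    moreover have "v ` S \<subseteq> {y. \<forall>s\<in>S. y \<bullet> s \<le> g s}"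
      using v a_pos \<open>\<rho> > 0\<close> \<open>A > 0\<close> by (auto intro!: divide_nonneg_pos)
    ultimately show "y \<in> {y. \<forall>s\<in>S. y \<bullet> s \<le> g s}" using y hull_minimal by blast
  qed
  ultimately show ?thesis unfolding simplex_def by blast
qed

end

subsection \<open>Shrinking the circumscribed simplex\<close>

locale exposing_simplex = simplex_normals S a for S :: "'a::euclidean_space set" and a +
  fixes K :: "'a set" and p :: "'a \<Rightarrow> 'a"
  assumes compact_K: "compact K"
    and inj_p: "inj_on p S"
    and exposes_p: "\<And>s. s \<in> S \<Longrightarrow> exposes K s (p s)"
begin

text \<open>Containment of projections along \<open>u\<close>, lifted to the whole space: the
  translation \<open>t\<close> is common to all points, while the slide \<open>r\<close> along
  \<open>u\<close> may depend on \<open>y\<close>. The bounds \<open>p s \<bullet> s - e\<close> are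
  the support values of \<open>K\<close> reduced by \<open>e\<close>.\<close>

definition fits :: "'a \<Rightarrow> real \<Rightarrow> bool" where
  "fits u e \<longleftrightarrow> (\<exists>t. \<forall>y\<in>K. \<exists>r. \<forall>s\<in>S. (y + t + r *\<^sub>R u) \<bullet> s \<le> p s \<bullet> s - e)"

lemma fits_antimono: "fits u e \<Longrightarrow> e' \<le> e \<Longrightarrow> fits u e'"
  unfolding fits_def by (meson diff_left_mono order_trans)

lemma le_p: "s \<in> S \<Longrightarrow> y \<in> K \<Longrightarrow> y \<bullet> s \<le> p s \<bullet> s"
  using exposes_p[of s] unfolding exposes_def by (cases "y = p s") (auto simp: less_imp_le)

lemma less_p: "s \<in> S \<Longrightarrow> y \<in> K \<Longrightarrow> y \<noteq> p s \<Longrightarrow> y \<bullet> s < p s \<bullet> s"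
  using exposes_p[of s] unfolding exposes_def by auto

text \<open>A point of \<open>K\<close> lies on at most one facet of the circumscribed simplex, so it can be moved
  along \<open>\<plusminus>u\<close> off that facet unless \<open>u\<close> is parallel to the facet.\<close>

lemma move_inside:
  assumes "y \<in> K"
  shows "\<exists>r. \<forall>s\<in>{s \<in> S. u \<bullet> s \<noteq> 0}. (y + r *\<^sub>R u) \<bullet> s < p s \<bullet> s"
proof (cases "\<exists>s\<in>S. u \<bullet> s \<noteq> 0 \<and> y = p s")
  case False
  then show ?thesis using less_p[OF _ assms] by (intro exI[of _ 0]) auto
next
  case True
  then obtain s1 where s1: "s1 \<in> S" "u \<bullet> s1 \<noteq> 0" "y = p s1" by blast
  have other: "y \<bullet> s < p s \<bullet> s" if "s \<in> S" "s \<noteq> s1" for s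
    using less_p[OF that(1) assms] s1 that inj_p by (auto dest: inj_onD)
  define \<sigma> where "\<sigma> = - sgn (u \<bullet> s1)"
  \<comment> \<open>The sign \<open>\<sigma>\<close> makes the slide leave the facet of
    \<open>s1\<close> inwards; the other strict inequalities survive a small slide by
    continuity.\<close>
  have "\<forall>\<^sub>F e in at_right 0. \<forall>s\<in>S. (y + (e * \<sigma>) *\<^sub>R u) \<bullet> s < p s \<bullet> s"
  proof (intro eventually_ball_finite ballI finite_S)
    fix s assume s: "s \<in> S"
    show "\<forall>\<^sub>F e in at_right 0. (y + (e * \<sigma>) *\<^sub>R u) \<bullet> s < p s \<bullet> s"
    proof (cases "s = s1")
      case True
      have "\<forall>\<^sub>F e in at_right (0::real). e > 0" by (simp add: eventually_at_right_less)
      then show ?thesis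
      proof eventually_elim
        case (elim e)
        have "e * \<bar>u \<bullet> s1\<bar> > 0" using elim s1 by simp
        moreover have "\<sigma> * (u \<bullet> s1) = - \<bar>u \<bullet> s1\<bar>" by (simp add: \<sigma>_def abs_sgn mult.commute)
        ultimately show ?case using True s1 by (simp add: inner_add_left mult.assoc)
      qed
    next
      case False
      have "((\<lambda>e. (y + (e * \<sigma>) *\<^sub>R u) \<bullet> s) \<longlongrightarrow> (y + (0 * \<sigma>) *\<^sub>R u) \<bullet> s) (at_right 0)"
        by (intro tendsto_intros)
      then show ?thesis using other[OF s False] by (intro order_tendstoD(2)) auto
    qed
  qed
  then obtain e where "\<forall>s\<in>S. (y + (e * \<sigma>) *\<^sub>R u) \<bullet> s < p s \<bullet> s"
    using eventually_happens'[of "at_right (0::real)"] trivial_limit_at_right_real by blast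
  then show ?thesis by blast
qed

text \<open>A slide that works strictly at \<open>y\<close> works near \<open>y\<close>, so
  compactness of \<open>K\<close> applies. The bound \<open>1 / e\<close> on the slide is recorded
  so that \<open>u\<close> can be varied later; a single constant serves as margin and as
  bound.\<close>

lemma move_inside_uniform:
  "\<exists>e>0. \<forall>y\<in>K. \<exists>r. \<bar>r\<bar> \<le> 1 / e \<and> (\<forall>s\<in>{s \<in> S. u \<bullet> s \<noteq> 0}. (y + r *\<^sub>R u) \<bullet> s \<le> p s \<bullet> s - e)"
proof (rule compact_uniform_eps[OF compact_K])
  fix y assume "y \<in> K"
  define N where "N = {s \<in> S. u \<bullet> s \<noteq> 0}"
  have "finite N" using finite_S by (simp add: N_def)
  obtain r where r: "\<forall>s\<in>N. (y + r *\<^sub>R u) \<bullet> s < p s \<bullet> s"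
    using move_inside[OF \<open>y \<in> K\<close>] unfolding N_def by blast
  \<comment> \<open>Half the slacks keep the inequalities strict, hence open in \<open>y\<close>;
    the first entry bounds \<open>r\<close> by \<open>1 / m\<close>.\<close>
  define m where "m = Min (insert (1 / (\<bar>r\<bar> + 1)) ((\<lambda>s. (p s \<bullet> s - (y + r *\<^sub>R u) \<bullet> s) / 2) ` N))"
  have "m > 0" unfolding m_def using \<open>finite N\<close> r by (subst Min_gr_iff) auto
  have "m \<le> 1 / (\<bar>r\<bar> + 1)" unfolding m_def using \<open>finite N\<close> by (intro Min_le) auto
  then have "\<bar>r\<bar> \<le> 1 / m" using \<open>m > 0\<close> by (simp add: field_simps)
  have m: "(y + r *\<^sub>R u) \<bullet> s < p s \<bullet> s - m" if "s \<in> N" for s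
  proof -
    have "m \<le> (p s \<bullet> s - (y + r *\<^sub>R u) \<bullet> s) / 2"
      unfolding m_def using \<open>finite N\<close> that by (intro Min_le) auto
    then show ?thesis using r that by force
  qed
  have "open (\<Inter>s\<in>N. {z. (z + r *\<^sub>R u) \<bullet> s < p s \<bullet> s - m})"
    using \<open>finite N\<close> by (intro open_INT ballI open_Collect_less continuous_intros)
  moreover have "y \<in> (\<Inter>s\<in>N. {z. (z + r *\<^sub>R u) \<bullet> s < p s \<bullet> s - m})" using m by auto
  ultimately obtain d where "d > 0" "ball y d \<subseteq> (\<Inter>s\<in>N. {z. (z + r *\<^sub>R u) \<bullet> s < p s \<bullet> s - m})"
    by (rule openE)
  then show "\<exists>d>0. \<exists>e>0. \<forall>v\<in>ball y d. \<exists>r. \<bar>r\<bar> \<le> 1 / e \<and>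
      (\<forall>s\<in>{s \<in> S. u \<bullet> s \<noteq> 0}. (v + r *\<^sub>R u) \<bullet> s \<le> p s \<bullet> s - e)"
    unfolding N_def[symmetric] using \<open>m > 0\<close> \<open>\<bar>r\<bar> \<le> 1 / m\<close>
    by (intro exI[of _ d] conjI exI[of _ m] ballI exI[of _ r]) (auto simp: subset_iff less_imp_le)
next
  fix y e e'
  assume "\<exists>r. \<bar>r\<bar> \<le> 1 / e \<and> (\<forall>s\<in>{s \<in> S. u \<bullet> s \<noteq> 0}. (y + r *\<^sub>R u) \<bullet> s \<le> p s \<bullet> s - e)"
    and e: "(0::real) < e'" "e' \<le> e"
  then obtain r where r: "\<bar>r\<bar> \<le> 1 / e" "\<forall>s\<in>{s \<in> S. u \<bullet> s \<noteq> 0}. (y + r *\<^sub>R u) \<bullet> s \<le> p s \<bullet> s - e"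
    by blast
  moreover have "1 / e \<le> 1 / e'" using e by (simp add: frac_le)
  ultimately show "\<exists>r. \<bar>r\<bar> \<le> 1 / e' \<and> (\<forall>s\<in>{s \<in> S. u \<bullet> s \<noteq> 0}. (y + r *\<^sub>R u) \<bullet> s \<le> p s \<bullet> s - e')"
    using e by (intro exI[of _ r]) force
qed

text \<open>The translation moves \<open>K\<close> off all facets parallel to \<open>u\<close> simultaneously, which is possible
  because \<open>u\<close> is not parallel to all facets.\<close>

lemma fits_bounded:
  assumes "norm u = 1"
  shows "\<exists>t e. e > 0 \<and>
    (\<forall>y\<in>K. \<exists>r. \<bar>r\<bar> \<le> 1 / e \<and> (\<forall>s\<in>S. (y + t + r *\<^sub>R u) \<bullet> s \<le> p s \<bullet> s - e))"
proof -
  obtain s0 where s0: "s0 \<in> S" "u \<bullet> s0 \<noteq> 0"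
    using eq_if_inner_eq[of u 0] assms by force
  \<comment> \<open>Prescribes a move inwards at all facets but that of \<open>s0\<close>, whose
    value balances the weighted sum.\<close>
  define g where "g s = (if s = s0 then sum a (S - {s0}) / a s0 else - 1)" for s
  have "(\<Sum>s\<in>S. a s * g s) = a s0 * g s0 + (\<Sum>s\<in>S - {s0}. a s * g s)"
    using s0 finite_S by (simp add: sum.remove)
  also have "(\<Sum>s\<in>S - {s0}. a s * g s) = - sum a (S - {s0})"
    unfolding sum_negf[symmetric] by (intro sum.cong) (auto simp: g_def)
  finally have "(\<Sum>s\<in>S. a s * g s) = 0" using a_pos[OF s0(1)] by (simp add: g_def)
  then obtain t where t: "\<And>s. s \<in> S \<Longrightarrow> t \<bullet> s = g s" using solve_inner by blast
  obtain e where e: "e > 0"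
    "\<And>y. y \<in> K \<Longrightarrow> \<exists>r. \<bar>r\<bar> \<le> 1 / e \<and> (\<forall>s\<in>{s \<in> S. u \<bullet> s \<noteq> 0}. (y + r *\<^sub>R u) \<bullet> s \<le> p s \<bullet> s - e)"
    using move_inside_uniform by blast
  define M where "M = Max (insert 1 (g ` S))"
  have M: "M \<ge> 1" "\<And>s. s \<in> S \<Longrightarrow> g s \<le> M"
    unfolding M_def using finite_S by (auto intro: Max_ge)
  \<comment> \<open>Translating by \<open>\<delta> *\<^sub>R t\<close> costs at most half of the
    margin \<open>e\<close> at facets not parallel to \<open>u\<close> and gains
    \<open>\<delta>\<close> at the parallel ones.\<close>
  define \<delta> where "\<delta> = e / (2 * M)"
  have \<delta>: "\<delta> > 0" "\<delta> \<le> e / 2" "\<delta> * M = e / 2"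
    using e M by (auto simp: \<delta>_def field_simps)
  have "\<exists>r. \<bar>r\<bar> \<le> 1 / \<delta> \<and> (\<forall>s\<in>S. (y + \<delta> *\<^sub>R t + r *\<^sub>R u) \<bullet> s \<le> p s \<bullet> s - \<delta>)" if y: "y \<in> K" for y
  proof -
    obtain r where r: "\<bar>r\<bar> \<le> 1 / e"
      "\<And>s. s \<in> S \<Longrightarrow> u \<bullet> s \<noteq> 0 \<Longrightarrow> (y + r *\<^sub>R u) \<bullet> s \<le> p s \<bullet> s - e"
      using e(2)[OF y] by blast
    have "1 / e \<le> 1 / \<delta>" using \<delta> e by (simp add: frac_le)
    moreover have "(y + \<delta> *\<^sub>R t + r *\<^sub>R u) \<bullet> s \<le> p s \<bullet> s - \<delta>" if s: "s \<in> S" for s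
    proof (cases "u \<bullet> s = 0")
      case True
      then have "t \<bullet> s = - 1" using t[OF s] s0 by (auto simp: g_def)
      then show ?thesis using True le_p[OF s y] by (simp add: inner_add_left)
    next
      case False
      have "\<delta> * (t \<bullet> s) \<le> \<delta> * M" using M(2)[OF s] t[OF s] \<delta> by simp
      then show ?thesis using r(2)[OF s False] \<delta> by (simp add: inner_add_left)
    qed
    ultimately show ?thesis using r(1) by (intro exI[of _ r]) auto
  qed
  then show ?thesis using \<delta>(1) by blast
qed

text \<open>The translation and slides found for \<open>u\<close> still work for nearby
  \<open>v\<close> with half the margin, because the slides are bounded.\<close>

lemma fits_uniform: "\<exists>e>0. \<forall>u\<in>sphere 0 1. fits u e"
proof (rule compact_uniform_eps)
  fix u :: 'a assume "u \<in> sphere 0 1"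
  then obtain t e where e: "e > 0"
    "\<And>y. y \<in> K \<Longrightarrow> \<exists>r. \<bar>r\<bar> \<le> 1 / e \<and> (\<forall>s\<in>S. (y + t + r *\<^sub>R u) \<bullet> s \<le> p s \<bullet> s - e)"
    using fits_bounded[of u] by auto
  define M where "M = Max (insert 1 (norm ` S))"
  have M: "M \<ge> 1" "\<And>s. s \<in> S \<Longrightarrow> norm s \<le> M"
    unfolding M_def using finite_S by (auto intro: Max_ge)
  \<comment> \<open>Chosen so that a slide of length at most \<open>1 / e\<close> changes heights by
    at most \<open>1 / e * (d * M) = e / 2\<close>.\<close>
  define d where "d = e\<^sup>2 / (2 * M)"
  have "d > 0" using e M by (simp add: d_def)
  moreover have "fits v (e / 2)" if v: "v \<in> ball u d" for v
    unfolding fits_def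
  proof (intro exI[of _ t] ballI)
    fix y assume "y \<in> K"
    then obtain r where r: "\<bar>r\<bar> \<le> 1 / e" "\<And>s. s \<in> S \<Longrightarrow> (y + t + r *\<^sub>R u) \<bullet> s \<le> p s \<bullet> s - e"
      using e(2) by blast
    have "(y + t + r *\<^sub>R v) \<bullet> s \<le> p s \<bullet> s - e / 2" if s: "s \<in> S" for s
    proof -
      have "\<bar>(v - u) \<bullet> s\<bar> \<le> norm (v - u) * norm s" by (rule Cauchy_Schwarz_ineq2)
      also have "\<dots> \<le> d * M" using v M(2)[OF s]
        using \<open>d > 0\<close> by (intro mult_mono) (auto simp: dist_norm norm_minus_commute)
      finally have "\<bar>r\<bar> * \<bar>(v - u) \<bullet> s\<bar> \<le> 1 / e * (d * M)"
        using r e by (intro mult_mono) auto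
      also have "\<dots> = e / 2" using e M by (simp add: d_def power2_eq_square)
      finally have "r * ((v - u) \<bullet> s) \<le> e / 2" by (simp flip: abs_mult)
      moreover have "(y + t + r *\<^sub>R v) \<bullet> s = (y + t + r *\<^sub>R u) \<bullet> s + r * ((v - u) \<bullet> s)"
        by (simp add: inner_add_left inner_diff_left algebra_simps)
      ultimately show ?thesis using r(2)[OF s] by linarith
    qed
    then show "\<exists>r. \<forall>s\<in>S. (y + t + r *\<^sub>R v) \<bullet> s \<le> p s \<bullet> s - e / 2" by blast
  qed
  ultimately show "\<exists>d>0. \<exists>e>0. \<forall>v\<in>ball u d. fits v e"
    using e by (intro exI[of _ d] conjI exI[of _ "e / 2"]) auto
next
  fix u e e' assume "fits u e" "0 < e'" "e' \<le> e"
  then show "fits u e'" using fits_antimono by blast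
qed simp

text \<open>The weighted heights of \<open>p s0\<close> sum to zero and lie below the support
  values, strictly at a second normal \<open>s1\<close>.\<close>

lemma sum_support_pos: "(\<Sum>s\<in>S. a s * (p s \<bullet> s)) > 0"
proof -
  obtain s0 where s0: "s0 \<in> S" using S_nonempty by blast
  then have "card (S - {s0}) > 0" using card_S finite_S by simp
  then obtain s1 where s1: "s1 \<in> S" "s1 \<noteq> s0" by (auto simp: card_gt_0_iff)
  have z: "p s0 \<in> K" using exposes_p[OF s0] by (simp add: exposes_def)
  have "p s0 \<noteq> p s1" using inj_p s0 s1 by (auto dest: inj_onD)
  then have "(\<Sum>s\<in>S. a s * (p s0 \<bullet> s)) < (\<Sum>s\<in>S. a s * (p s \<bullet> s))"
    using less_p[OF s1(1) z] le_p[OF _ z] a_pos s1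
    by (intro sum_strict_mono_ex1 finite_S) (auto intro!: mult_left_mono less_imp_le bexI[of _ s1])
  then show ?thesis using sum_inner_zero by simp
qed

text \<open>The projection annihilates the slide \<open>r *\<^sub>R u\<close>, so the projection of
  \<open>t\<close> is the required translation.\<close>

lemma proj_perp_contains_translate:
  assumes "norm u = 1" "fits u e"
  shows "contains_translate (proj_perp u {y. \<forall>s\<in>S. y \<bullet> s \<le> p s \<bullet> s - e}) (proj_perp u K)"
proof -
  obtain t where t: "\<And>y. y \<in> K \<Longrightarrow> \<exists>r. \<forall>s\<in>S. (y + t + r *\<^sub>R u) \<bullet> s \<le> p s \<bullet> s - e"
    using assms(2) unfolding fits_def by blast
  let ?P = "\<lambda>x. x - (x \<bullet> u) *\<^sub>R u"
  have uu: "u \<bullet> u = 1" using assms(1) by (simp add: dot_square_norm)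
  have "?P t + ?P y \<in> ?P ` {y. \<forall>s\<in>S. y \<bullet> s \<le> p s \<bullet> s - e}" if "y \<in> K" for y
  proof -
    obtain r where r: "\<forall>s\<in>S. (y + t + r *\<^sub>R u) \<bullet> s \<le> p s \<bullet> s - e" using t \<open>y \<in> K\<close> by blast
    have "?P t + ?P y = ?P (y + t + r *\<^sub>R u)"
      by (simp add: inner_add_left uu algebra_simps)
    then show ?thesis using r by (intro image_eqI) auto
  qed
  then show ?thesis
    unfolding contains_translate_def proj_perp_def by (intro exI[of _ "?P t"]) auto
qed

text \<open>Testing the contact points forces \<open>t \<bullet> s \<le> - e\<close> for every
  normal, but the weighted sum of these numbers is zero.\<close>

lemma not_contains_translate:
  assumes "e > 0"
  shows "\<not> contains_translate {y. \<forall>s\<in>S. y \<bullet> s \<le> p s \<bullet> s - e} K"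
proof
  assume "contains_translate {y. \<forall>s\<in>S. y \<bullet> s \<le> p s \<bullet> s - e} K"
  then obtain t where t: "\<And>y s. y \<in> K \<Longrightarrow> s \<in> S \<Longrightarrow> (t + y) \<bullet> s \<le> p s \<bullet> s - e"
    unfolding contains_translate_def by blast
  have neg: "t \<bullet> s \<le> - e" if "s \<in> S" for s
    using t[of "p s" s] exposes_p[OF that] that by (simp add: exposes_def inner_add_left)
  have "(\<Sum>s\<in>S. a s * (t \<bullet> s)) \<le> (\<Sum>s\<in>S. a s * (- e))"
    using neg a_pos by (intro sum_mono mult_left_mono) (auto simp: less_imp_le)
  also have "\<dots> = - (sum a S * e)" by (simp add: sum_negf sum_distrib_right)
  also have "\<dots> < 0" using sum_a_pos assms by simp
  finally show False using sum_inner_zero by simp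
qed

end

section \<open>Choice of the inward shift and assembly of the simplex\<close>

theorem theorem3p4:
  fixes K :: "'a::euclidean_space set"
  assumes "compact K" and "convex K"
    and "\<exists>E. E \<subseteq> {x. exposed_point K x} \<and> finite E \<and> card E = DIM('a) + 1"
  shows "\<exists>S. int DIM('a) simplex S \<and>
           (\<forall>u. norm u = 1 \<longrightarrow> contains_translate (proj_perp u S) (proj_perp u K)) \<and>
           \<not> contains_translate S K"
proof -
  obtain E where E: "finite E" "card E = DIM('a) + 1" "\<And>x. x \<in> E \<Longrightarrow> exposed_point K x"
    using assms(3) by blast
  obtain N a p where N: "finite N" "card N = DIM('a) + 1"
    "\<And>T. T \<subseteq> N \<Longrightarrow> card T \<le> DIM('a) \<Longrightarrow> independent T"
    "\<And>s. s \<in> N \<Longrightarrow> a s > 0" "(\<Sum>s\<in>N. a s *\<^sub>R s) = 0"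
    "inj_on p N" "\<And>s. s \<in> N \<Longrightarrow> exposes K s (p s)"
    using exposing_simplex_normals[OF assms(1) E] by blast
  interpret exposing_simplex N a K p
    using N assms(1) by unfold_locales
  obtain e0 where e0: "e0 > 0" "\<And>u. norm u = 1 \<Longrightarrow> fits u e0" using fits_uniform by auto
  define H where "H = (\<Sum>s\<in>N. a s * (p s \<bullet> s))"
  \<comment> \<open>The first bound keeps \<open>fits\<close>; the second leaves at least half of
    \<open>H\<close>, so the shrunk simplex does not degenerate.\<close>
  define e where "e = min e0 (H / (2 * sum a N))"
  have "H > 0" using sum_support_pos by (simp add: H_def)
  then have "e > 0" using e0 sum_a_pos by (simp add: e_def)
  have "e * sum a N \<le> H / (2 * sum a N) * sum a N"
    using sum_a_pos by (intro mult_right_mono) (auto simp: e_def)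
  then have "e * sum a N < H" using \<open>H > 0\<close> sum_a_pos by simp
  moreover have "(\<Sum>s\<in>N. a s * (p s \<bullet> s - e)) = H - e * sum a N"
    by (simp add: H_def right_diff_distrib sum_subtractf sum_distrib_left mult.commute)
  ultimately have "(\<Sum>s\<in>N. a s * (p s \<bullet> s - e)) > 0" by simp
  then have "int DIM('a) simplex {y. \<forall>s\<in>N. y \<bullet> s \<le> p s \<bullet> s - e}"
    by (rule simplex_halfspaces)
  moreover have "fits u e" if "norm u = 1" for u
    using fits_antimono[OF e0(2)[OF that]] by (simp add: e_def)
  ultimately show ?thesis
    using proj_perp_contains_translate not_contains_translate[OF \<open>e > 0\<close>] by blast
qed

end
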